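(* Let $s, t$ be positive integers and suppose $r(s,t) = p$, where $r(s,t)$ is the Ramsey number. If $G$ is a graph obtained from the complete graph $K_p$ by deleting a single edge, then there is a coloring of the edges of $G$ with the two colors red and blue such that, with respect to this coloring, $G$ contains neither a red $K_s$ nor a blue $K_t$.
   Context: For a positive integer $n$, $K_n$ denotes the complete graph on $n$ vertices, i.e. the graph with $n$ vertices containing every possible edge between distinct vertices. A red/blue edge coloring of a graph assigns to each edge exactly one of the colors red or blue (adjacent edges may receive the same color). A red $K_s$ (respectively blue $K_t$) is a complete subgraph on $s$ (respectively $t$) vertices all of whose edges are red (respectively blue). For positive integers $s,t$, the Ramsey number $r(s,t)$ is the smallest positive integer $p$ such that every red/blue coloring of the edges of $K_p$ contains a red $K_s$ or a blue $K_t$; it exists for all $s,t$ by Ramsey's theorem. *)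

theory Defs
  imports "HOL-Library.Ramsey"
begin

text \<open>
  A graph is given by a vertex set \<open>V\<close> and a set \<open>E\<close> of edges, each edge being a two-element
  subset of \<open>V\<close>; thus the complete graph on \<open>V\<close> has edge set \<open>nsets V 2\<close>.
  A red/blue edge coloring is a total function on sets of vertices of which only the values on \<open>E\<close>
  matter: \<open>has_mono_clique\<close> below never looks at the color of a non-edge.
\<close>

datatype color = Red | Blue

definition has_mono_clique ::
    "'a set \<Rightarrow> 'a set set \<Rightarrow> ('a set \<Rightarrow> color) \<Rightarrow> color \<Rightarrow> nat \<Rightarrow> bool" where
  "has_mono_clique V E c k n \<longleftrightarrow> (\<exists>K \<in> nsets V n. clique K {e \<in> E. c e = k})"

definition ramsey_number :: "nat \<Rightarrow> nat \<Rightarrow> nat" where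
  "ramsey_number s t = (LEAST p. 0 < p \<and>
     (\<forall>c. has_mono_clique {..<p} (nsets {..<p} 2) c Red s \<or>
          has_mono_clique {..<p} (nsets {..<p} 2) c Blue t))"

text \<open>By Ramsey's theorem the \<open>LEAST\<close> above ranges over a nonempty set.\<close>

lemma ramsey_number_exists:
  assumes "0 < s" "0 < t"
  shows "\<exists>p::nat. 0 < p \<and>
     (\<forall>c. has_mono_clique {..<p} (nsets {..<p} 2) c Red s \<or>
          has_mono_clique {..<p} (nsets {..<p} 2) c Blue t)"
proof -
  obtain r :: nat where r: "r \<ge> 1"
    "\<And>(V :: nat set) E. finite V \<Longrightarrow> card V \<ge> r \<Longrightarrow>
       \<exists>R \<subseteq> V. card R = s \<and> clique R E \<or> card R = t \<and> indep R E"
    using ramsey2[of s t] by blast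
  have "has_mono_clique {..<r} (nsets {..<r} 2) c Red s \<or>
        has_mono_clique {..<r} (nsets {..<r} 2) c Blue t" for c
  proof -
    obtain R where R: "R \<subseteq> {..<r}"
      "card R = s \<and> clique R {e. c e = Red} \<or> card R = t \<and> indep R {e. c e = Red}"
      using r(2)[of "{..<r}" "{e. c e = Red}"] by auto
    have fin: "finite R"
      using R(1) finite_subset by blast
    have not_red: "k \<noteq> Red \<Longrightarrow> k = Blue" for k
      by (cases k) auto
    from R(2) show ?thesis
    proof
      assume a: "card R = s \<and> clique R {e. c e = Red}"
      have "R \<in> nsets {..<r} s" "clique R {e \<in> nsets {..<r} 2. c e = Red}"
        using a R(1) fin by (auto simp: nsets_def[of _ s] clique_def)
      then show ?thesis by (auto simp: has_mono_clique_def)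
    next
      assume a: "card R = t \<and> indep R {e. c e = Red}"
      have "R \<in> nsets {..<r} t" "clique R {e \<in> nsets {..<r} 2. c e = Blue}"
        using a R(1) fin not_red by (auto simp: nsets_def[of _ t] clique_def indep_def)
      then show ?thesis by (auto simp: has_mono_clique_def)
    qed
  qed
  with r(1) show ?thesis by (intro exI[of _ r]) auto
qed

end

(* Idea: give the edges of a complete graph on p - 1 vertices a good coloring, which exists by
   minimality of p. Identifying the two ends of the deleted edge maps G homomorphically onto this
   graph, and a homomorphism between loopless graphs is injective on cliques, so the pulled-back
   coloring of G is good as well. *)

theory Submission
  imports Defs
begin

text \<open>If \<open>\<phi>\<close> identified two vertices of a clique, the edge joining them
  would have a singleton as image, which is not in \<open>nsets W 2\<close>. So the image of the
  clique still has \<open>n\<close> vertices.\<close>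

lemma has_mono_clique_hom:
  assumes hom: "\<And>e. e \<in> E \<Longrightarrow> \<phi> ` e \<in> nsets W 2"
    and vert: "\<phi> ` V \<subseteq> W"
    and "has_mono_clique V E (\<lambda>e. c (\<phi> ` e)) k n"
  shows "has_mono_clique W (nsets W 2) c k n"
proof -
  obtain K where K: "K \<subseteq> V" "finite K" "card K = n"
    and edge: "\<And>x y. x \<in> K \<Longrightarrow> y \<in> K \<Longrightarrow> x \<noteq> y \<Longrightarrow> {x, y} \<in> E \<and> c (\<phi> ` {x, y}) = k"
    using assms(3) by (auto simp: has_mono_clique_def nsets_def clique_def)
  have image: "{\<phi> x, \<phi> y} \<in> nsets W 2 \<and> c {\<phi> x, \<phi> y} = k"
    if "x \<in> K" "y \<in> K" "x \<noteq> y" for x y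
    using hom[of "{x, y}"] edge[OF that] by simp
  have "inj_on \<phi> K"
  proof (rule inj_onI, rule ccontr)
    fix x y assume "x \<in> K" "y \<in> K" "\<phi> x = \<phi> y" "x \<noteq> y"
    then show False using image[of x y] by (simp add: nsets_def)
  qed
  then have "\<phi> ` K \<in> nsets W n"
    using K vert by (auto simp: nsets_def card_image)
  moreover have "clique (\<phi> ` K) {e \<in> nsets W 2. c e = k}"
    unfolding clique_def using image by blast
  ultimately show ?thesis
    unfolding has_mono_clique_def by blast
qed

text \<open>Minimality of the \<open>LEAST\<close>: its property fails at \<open>q\<close>, and
  \<open>0 < q\<close> ensures that the part about colorings is what fails.\<close>

lemma ramsey_number_good_coloring:
  assumes "0 < q" "q < ramsey_number s t"
  obtains c where "\<not> has_mono_clique {..<q} (nsets {..<q} 2) c Red s"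
    "\<not> has_mono_clique {..<q} (nsets {..<q} 2) c Blue t"
  using not_less_Least[OF assms(2)[unfolded ramsey_number_def]] assms(1) by blast

theorem mainTheorem1:
  fixes s t p :: nat and V :: "'a set" and E :: "'a set set" and e :: "'a set"
  assumes "0 < s" and "0 < t"
    and "ramsey_number s t = p"
    and "finite V" and "card V = p"
    and "e \<in> nsets V 2"
    and "E = nsets V 2 - {e}"
  shows "\<exists>c. \<not> has_mono_clique V E c Red s \<and> \<not> has_mono_clique V E c Blue t"
proof -
  obtain u v where e: "e = {u, v}" "u \<in> V" "v \<in> V" "u \<noteq> v"
    using assms(6) by (blast elim: nsets2_E)
  define q where "q = card (V - {v})"
  \<comment> \<open>The vertex \<open>u\<close> survives the removal of \<open>v\<close>.\<close>
  have "0 < q"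
    unfolding q_def card_gt_0_iff using e assms(4) by blast
  moreover have "q < ramsey_number s t"
    unfolding q_def assms(3) assms(5)[symmetric] using assms(4) e(3) by (rule card_Diff1_less)
  ultimately obtain c where c: "\<not> has_mono_clique {..<q} (nsets {..<q} 2) c Red s"
      "\<not> has_mono_clique {..<q} (nsets {..<q} 2) c Blue t"
    by (rule ramsey_number_good_coloring)
  obtain g where g: "bij_betw g (V - {v}) {..<q}"
    using ex_bij_betw_finite_nat[of "V - {v}"] assms(4)
    by (auto simp: q_def atLeast0LessThan)
  \<comment> \<open>Identifies \<open>v\<close> with \<open>u\<close>; \<open>g\<close> itself is
    controlled only on \<open>V - {v}\<close>.\<close>
  define \<phi> where "\<phi> = g(v := g u)"
  have vert: "\<phi> ` V \<subseteq> {..<q}"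
    using g e by (auto simp: \<phi>_def bij_betw_def)
  have hom: "\<phi> ` d \<in> nsets {..<q} 2" if dE: "d \<in> E" for d
  proof -
    obtain x y where d: "d = {x, y}" "x \<in> V" "y \<in> V" "x \<noteq> y" "{x, y} \<noteq> {u, v}"
      using dE unfolding assms(7) e(1) by (blast elim: nsets2_E)
    have inj: "inj_on g (V - {v})"
      using g by (simp add: bij_betw_def)
    \<comment> \<open>Away from \<open>v\<close> this is injectivity of \<open>g\<close>. If one end
      is \<open>v\<close>, equal images force the other end to be \<open>u\<close>, and the edge
      would be the deleted one.\<close>
    have "\<phi> x \<noteq> \<phi> y"
    proof
      assume "\<phi> x = \<phi> y"
      then show False
        using d(2-5) e(2-4) inj_on_eq_iff[OF inj]
        by (cases "x = v"; cases "y = v") (auto simp: \<phi>_def insert_commute)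
    qed
    moreover have "\<phi> x \<in> {..<q}" "\<phi> y \<in> {..<q}"
      using vert d by auto
    ultimately show ?thesis
      by (simp add: d(1) nsets_def)
  qed
  \<comment> \<open>The witness gives each edge the color that \<open>c\<close> assigns to its image
    under \<open>\<phi>\<close>.\<close>
  show ?thesis
    using has_mono_clique_hom[OF hom vert] c by blast
qed

end
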